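(* For any language $L\subseteq\Sigma^+$: $L\in\mathtt{incl}$-$\mathtt{ESO}$-$\mathtt{HORN}$ if and only if $(\Sigma^+\setminus L)\in LinConj$.
   Context: Fix a finite alphabet $\Sigma$. A nonempty word $w=w_1\cdots w_n$ is represented by the structure $\langle w\rangle=([1,n];(Q_s)_{s\in\Sigma},\mathtt{min},\mathtt{max},\mathtt{suc},\mathtt{pred})$ with $Q_s(i)\iff w_i=s$, $\mathtt{min}(i)\iff i=1$, $\mathtt{max}(i)\iff i=n$, $\mathtt{suc}(i)=\min(i+1,n)$, $\mathtt{pred}(i)=\max(i-1,1)$. For an integer $a$, $x+a$ denotes $\mathtt{suc}^a(x)$ if $a\ge0$ and $\mathtt{pred}^{-a}(x)$ if $a<0$; $y-b=\mathtt{pred}^b(y)$. An inclusion Horn formula is $\Phi=\exists\mathbf{R}\forall x\forall y\,\psi(x,y)$, $\mathbf{R}$ a finite set of binary relation symbols, $\psi$ a conjunction of Horn clauses over the signature $\{(Q_s)_{s\in\Sigma},\mathtt{min},\mathtt{max},\mathtt{suc},\mathtt{pred}\}\cup\mathbf{R}\cup\{=,\le,<\}$ (with the usual order on $[1,n]$), each of the form $x\le y\wedge\delta_1\wedge\cdots\wedge\delta_r\to\delta_0$ with $\delta_0$ an atom $R(x,y)$ ($R\in\mathbf{R}$) or $\bot$, and each $\delta_i$ one of: $U(x+a)$, $\neg U(x+a)$, $U(y+a)$, $\neg U(y+a)$ for $U\in\{(Q_s)_{s\in\Sigma},\mathtt{min},\mathtt{max}\}$ and $a\in\mathbb Z$;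 $x=y$ or $x<y$; a conjunction $S(x+a,y-b)\wedge x+a\le y-b$ with $S\in\mathbf{R}$ and integers $a,b\ge0$. $\mathtt{incl}$-$\mathtt{ESO}$-$\mathtt{HORN}$ is the class of languages $\{w\in\Sigma^+:\langle w\rangle\models\Phi\}$ for such $\Phi$. A linear conjunctive grammar is $G=(\Sigma,N,P,S)$ with nonterminals $N$, start symbol $S\in N$ and a finite set $P$ of rules $A\to\alpha_1\&\cdots\&\alpha_k$ ($k\ge1$) with each $\alpha_i\in\Sigma^*\cup\Sigma^*N\Sigma^*$. The languages $(L(A))_{A\in N}$ are the least (componentwise for inclusion) solution of the system $L(A)=\bigcup_{(A\to\alpha_1\&\cdots\&\alpha_k)\in P}\bigcap_{i=1}^kL(\alpha_i)$, where $L(uBv)=u\,L(B)\,v$ and $L(u)=\{u\}$ for $u,v\in\Sigma^*$, $B\in N$. $L(G)=L(S)$, and $LinConj$ is the class of languages generated by linear conjunctive grammars. *)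

theory Defs
  imports Main
begin

text \<open>A nonempty word w of length n is seen as the structure on positions 1..n.
  Positions are natural numbers; position i carries the letter w ! (i - 1).\<close>

definition suc_pos :: "nat \<Rightarrow> nat \<Rightarrow> nat" where
  "suc_pos n i = min (i + 1) n"

definition pred_pos :: "nat \<Rightarrow> nat" where
  "pred_pos i = max (i - 1) 1"

definition shift_pos :: "nat \<Rightarrow> nat \<Rightarrow> int \<Rightarrow> nat" where
  "shift_pos n i a = (if a \<ge> 0 then (suc_pos n ^^ nat a) i else (pred_pos ^^ nat (- a)) i)"

datatype 'a unary_sym = QSym 'a | MinSym | MaxSym

datatype var = VX | VY

text \<open>Hypotheses delta_i of a clause.  Relation symbols of R are named by natural numbers.
  UAtom True U v a  is  U(v+a);  UAtom False U v a  is  \<not> U(v+a).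
  RelAtom S a b  is  S(x+a, y-b) \<and> x+a \<le> y-b  with a, b \<ge> 0.\<close>
datatype 'a hyp =
    UAtom bool "'a unary_sym" var int
  | EqXY
  | LtXY
  | RelAtom nat nat nat

datatype head = HeadRel nat | HeadBot

text \<open>A clause  x \<le> y \<and> delta_1 \<and> ... \<and> delta_r \<longrightarrow> delta_0;
  a formula psi is a (finite) conjunction of clauses.  The (finite) set R of
  relation symbols consists of those names used; unused names are irrelevant.\<close>
type_synonym 'a clause = "'a hyp list \<times> head"
type_synonym 'a incl_horn = "'a clause list"

definition unary_holds :: "'a list \<Rightarrow> 'a unary_sym \<Rightarrow> nat \<Rightarrow> bool" where
  "unary_holds w U i = (case U of
       QSym s \<Rightarrow> w ! (i - 1) = s
     | MinSym \<Rightarrow> i = 1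
     | MaxSym \<Rightarrow> i = length w)"

fun hyp_holds :: "'a list \<Rightarrow> (nat \<Rightarrow> (nat \<times> nat) set) \<Rightarrow> nat \<Rightarrow> nat \<Rightarrow> 'a hyp \<Rightarrow> bool" where
  "hyp_holds w I x y (UAtom b U v a) =
     (unary_holds w U (shift_pos (length w) (case v of VX \<Rightarrow> x | VY \<Rightarrow> y) a) = b)"
| "hyp_holds w I x y EqXY = (x = y)"
| "hyp_holds w I x y LtXY = (x < y)"
| "hyp_holds w I x y (RelAtom S a b) =
     (let p = shift_pos (length w) x (int a); q = shift_pos (length w) y (- int b)
      in (p, q) \<in> I S \<and> p \<le> q)"

fun head_holds :: "(nat \<Rightarrow> (nat \<times> nat) set) \<Rightarrow> nat \<Rightarrow> nat \<Rightarrow> head \<Rightarrow> bool" where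
  "head_holds I x y (HeadRel R) = ((x, y) \<in> I R)"
| "head_holds I x y HeadBot = False"

definition clause_holds :: "'a list \<Rightarrow> (nat \<Rightarrow> (nat \<times> nat) set) \<Rightarrow> nat \<Rightarrow> nat \<Rightarrow> 'a clause \<Rightarrow> bool" where
  "clause_holds w I x y c =
     ((x \<le> y \<and> (\<forall>h\<in>set (fst c). hyp_holds w I x y h)) \<longrightarrow> head_holds I x y (snd c))"

definition incl_horn_models :: "'a list \<Rightarrow> 'a incl_horn \<Rightarrow> bool" where
  "incl_horn_models w \<Phi> =
     (\<exists>I :: nat \<Rightarrow> (nat \<times> nat) set.
        (\<forall>R. I R \<subseteq> {1..length w} \<times> {1..length w}) \<and>
        (\<forall>x\<in>{1..length w}. \<forall>y\<in>{1..length w}. \<forall>c\<in>set \<Phi>. clause_holds w I x y c))"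

definition incl_ESO_HORN :: "'a list set set" where
  "incl_ESO_HORN = {L. \<exists>\<Phi>. L = {w. w \<noteq> [] \<and> incl_horn_models w \<Phi>}}"

text \<open>Nonterminals are natural numbers. A conjunct is either a terminal word u or u B v.\<close>
datatype 'a lconj = TermW "'a list" | NTW "'a list" nat "'a list"

type_synonym 'a lcg_rules = "(nat \<times> 'a lconj list) list"

fun conj_lang :: "(nat \<Rightarrow> 'a list set) \<Rightarrow> 'a lconj \<Rightarrow> 'a list set" where
  "conj_lang X (TermW u) = {u}"
| "conj_lang X (NTW u B v) = {u @ z @ v | z. z \<in> X B}"

definition lcg_step :: "'a lcg_rules \<Rightarrow> (nat \<Rightarrow> 'a list set) \<Rightarrow> (nat \<Rightarrow> 'a list set)" where
  "lcg_step P X = (\<lambda>A. \<Union>{\<Inter>(conj_lang X ` set cs) | cs. (A, cs) \<in> set P})"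

definition lcg_lang :: "'a lcg_rules \<Rightarrow> nat \<Rightarrow> 'a list set" where
  "lcg_lang P S = lfp (lcg_step P) S"

definition LinConj :: "'a list set set" where
  "LinConj = {L. \<exists>P S. (\<forall>(A, cs)\<in>set P. cs \<noteq> []) \<and> L = lcg_lang P S}"

end

theory Submission
  imports Defs "HOL-Library.Countable" "HOL.Filter"
begin

text \<open>A word lies outside the language of a Horn formula iff \<open>\<bottom>\<close> is derivable in its least model, so both
  sides of the equivalence are least fixpoints.  Given a grammar for the complement, a relation per
  nonterminal \<open>A\<close> holds at \<open>(x, y)\<close> when the factor \<open>w\<^sub>x \<dots> w\<^sub>y\<close> lies in \<open>L(A)\<close>.  Conversely, a clause at
  \<open>(x, y)\<close> only inspects letters at bounded distance from \<open>x\<close> and \<open>y\<close>, possibly outside the factor,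
  so a nonterminal records a head together with the contexts of the factor, truncated to a bounded
  length \<open>K\<close>.  Factors of length at most \<open>2K\<close>, the only ones for which clamping at the ends of the
  word can affect a relational hypothesis, are generated outright by rules with a terminal right-hand side.\<close>

section \<open>Positions, factors and their occurrences\<close>

text \<open>Iterated \<open>suc_pos\<close> can only saturate at \<open>n\<close> and iterated
  \<open>pred_pos\<close> only at 1; the bound on the other side already holds for \<open>i\<close>,
  so one clamped sum serves both signs of \<open>a\<close>.\<close>

lemma shift_pos_eq:
  assumes "1 \<le> i" "i \<le> n"
  shows "shift_pos n i a = nat (max 1 (min (int n) (int i + a)))"
proof -
  have up: "(suc_pos n ^^ k) i = min n (i + k)" for k
    using assms by (induction k) (auto simp: suc_pos_def)
  have down: "(pred_pos ^^ k) i = max 1 (i - k)" for k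
    using assms by (induction k) (auto simp: pred_pos_def)
  show ?thesis
  proof (cases a rule: int_cases2)
    case (nonneg k)
    then have "shift_pos n i a = min n (i + k)" by (simp add: shift_pos_def up)
    then show ?thesis using assms nonneg by linarith
  next
    case (nonpos k)
    then have "shift_pos n i a = max 1 (i - k)" using assms by (auto simp: shift_pos_def down up)
    then show ?thesis using assms nonpos by linarith
  qed
qed

text \<open>\<open>d\<close> and \<open>e\<close> are the displacements left after clamping: there
  are \<open>length z - 1 + length s\<close> positions to the right of x and
  \<open>length p + length z - 1\<close> to the left of y. The guard that the shifted positions stay
  ordered turns into \<open>d + e < length z\<close>.\<close>

lemma hyp_holds_RelAtom_iff:
  fixes p z s :: "'a list" and a b :: nat
  assumes "z \<noteq> []"
  defines "d \<equiv> min a (length z - 1 + length s)" and "e \<equiv> min b (length p + length z - 1)"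
  shows "hyp_holds (p @ z @ s) I (Suc (length p)) (length p + length z) (RelAtom S a b) \<longleftrightarrow>
    d + e < length z \<and> (Suc (length p + d), length p + length z - e) \<in> I S"
proof -
  have "length z > 0" using assms(1) by simp
  then have "shift_pos (length (p @ z @ s)) (Suc (length p)) (int a) = Suc (length p + d)"
    "shift_pos (length (p @ z @ s)) (length p + length z) (- int b) = length p + length z - e"
    unfolding d_def e_def length_append by (subst shift_pos_eq; linarith)+
  then show ?thesis
    using \<open>length z > 0\<close> by (auto simp: Let_def e_def)
qed

lemma interval_split:
  fixes w :: "'a list"
  assumes "1 \<le> x" "x \<le> y" "y \<le> length w"
  obtains p z s where "w = p @ z @ s" "z \<noteq> []" "x = Suc (length p)" "y = length p + length z"
proof
  have "drop y w = drop (y - (x - 1)) (drop (x - 1) w)"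
    using assms by simp
  then show "w = take (x - 1) w @ take (y - (x - 1)) (drop (x - 1) w) @ drop y w"
    by (metis append_take_drop_id)
qed (use assms in auto)

text \<open>Pairs of positions are described through occurrences \<open>p @ z @ s\<close>, so that a
  relation may depend on the contexts of a factor as well as on the factor. Both model constructions
  have this shape.\<close>

definition spans :: "'a list \<Rightarrow> ('a list \<Rightarrow> 'a list \<Rightarrow> 'a list \<Rightarrow> bool) \<Rightarrow> (nat \<times> nat) set" where
  "spans w Q = {(Suc (length p), length p + length z) | p z s. w = p @ z @ s \<and> z \<noteq> [] \<and> Q p z s}"

lemma spans_iff:
  assumes "z \<noteq> []"
  shows "(Suc (length p), length p + length z) \<in> spans (p @ z @ s) Q \<longleftrightarrow> Q p z s"
  using assms unfolding spans_def by fastforce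

lemma spans_subset: "spans w Q \<subseteq> {1..length w} \<times> {1..length w}"
  by (force simp: spans_def Suc_le_eq)

section \<open>Least solutions of grammar systems\<close>

lemma mono_conj_lang: "X \<le> Y \<Longrightarrow> conj_lang X c \<subseteq> conj_lang Y c"
  by (cases c) (auto simp: le_fun_def)

lemma mono_lcg_step: "mono (lcg_step P)"
proof (rule monoI)
  fix X Y :: "nat \<Rightarrow> 'a list set"
  assume "X \<le> Y"
  then have step: "\<Inter>(conj_lang X ` set cs) \<subseteq> \<Inter>(conj_lang Y ` set cs)" for cs
    by (intro INF_mono) (blast dest: mono_conj_lang)
  show "lcg_step P X \<le> lcg_step P Y"
  proof (intro le_funI subsetI)
    fix A z assume "z \<in> lcg_step P X A"
    then obtain cs where "(A, cs) \<in> set P" "z \<in> \<Inter>(conj_lang X ` set cs)"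
      unfolding lcg_step_def by blast
    with step have "(A, cs) \<in> set P" "z \<in> \<Inter>(conj_lang Y ` set cs)" by blast+
    then show "z \<in> lcg_step P Y A" unfolding lcg_step_def by blast
  qed
qed

lemma lcg_lang_eq_lfp: "lcg_lang P = lfp (lcg_step P)"
  by (rule ext) (rule lcg_lang_def)

lemma lcg_lang_unfold: "lcg_lang P = lcg_step P (lcg_lang P)"
  unfolding lcg_lang_eq_lfp by (rule lfp_unfold[OF mono_lcg_step])

lemma lcg_lang_intro:
  assumes "(A, cs) \<in> set P" "\<And>c. c \<in> set cs \<Longrightarrow> z \<in> conj_lang (lcg_lang P) c"
  shows "z \<in> lcg_lang P A"
proof -
  have "z \<in> \<Inter>(conj_lang (lcg_lang P) ` set cs)" using assms(2) by blast
  then have "z \<in> lcg_step P (lcg_lang P) A" using assms(1) unfolding lcg_step_def by blast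
  then show ?thesis by (subst lcg_lang_unfold)
qed

text \<open>Induction on derivations: a family closed under every rule is a pre-fixpoint of
  \<open>lcg_step P\<close>, and the least fixpoint lies below it.\<close>

lemma lcg_lang_least:
  assumes "\<And>A cs z. (A, cs) \<in> set P \<Longrightarrow> (\<And>c. c \<in> set cs \<Longrightarrow> z \<in> conj_lang X c) \<Longrightarrow> z \<in> X A"
  shows "lcg_lang P A \<subseteq> X A"
proof -
  have "lcg_step P X \<le> X"
  proof (intro le_funI subsetI)
    fix A z assume "z \<in> lcg_step P X A"
    then obtain cs where "(A, cs) \<in> set P" "z \<in> \<Inter>(conj_lang X ` set cs)"
      unfolding lcg_step_def by blast
    then show "z \<in> X A" by (intro assms[of A cs]) auto
  qed
  then have "lfp (lcg_step P) \<le> X" by (rule lfp_lowerbound)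
  from le_funD[OF this] show ?thesis by (simp add: lcg_lang_eq_lfp)
qed

subsection \<open>From grammars to inclusion Horn formulas\<close>

definition prefix_hyps :: "'a list \<Rightarrow> 'a hyp list" where
  "prefix_hyps u = concat (map (\<lambda>i. [UAtom True (QSym (u ! i)) VX (int i), UAtom False MaxSym VX (int i)])
     [0..<length u])"

definition suffix_hyps :: "'a list \<Rightarrow> 'a hyp list" where
  "suffix_hyps v = concat (map (\<lambda>i. [UAtom True (QSym (rev v ! i)) VY (- int i), UAtom False MinSym VY (- int i)])
     [0..<length v])"

text \<open>Beyond the end of the word \<open>x + i\<close> is clamped, so the letter atoms alone
  could reread the last letter. The non-maximality atoms exclude this and leave at least one letter
  after \<open>u\<close>, hence the nonempty \<open>t\<close>.\<close>

lemma prefix_hyps_hold_iff: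
  assumes "q \<noteq> []"
  shows "(\<forall>h\<in>set (prefix_hyps u). hyp_holds (p @ q) I (Suc (length p)) y h) \<longleftrightarrow>
    (\<exists>t. t \<noteq> [] \<and> q = u @ t)"
proof -
  have pos: "length q > 0" using assms by simp
  have sh: "shift_pos (length (p @ q)) (Suc (length p)) (int i) = Suc (length p + min i (length q - 1))" for i
    unfolding length_append using pos by (subst shift_pos_eq; linarith)
  have "(\<forall>h\<in>set (prefix_hyps u). hyp_holds (p @ q) I (Suc (length p)) y h) \<longleftrightarrow>
     (\<forall>i<length u. q ! min i (length q - 1) = u ! i \<and> Suc (min i (length q - 1)) \<noteq> length q)"
    using pos by (auto simp: prefix_hyps_def unary_holds_def sh[simplified] nth_append)
  also have "\<dots> \<longleftrightarrow> (\<exists>t. t \<noteq> [] \<and> q = u @ t)"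
  proof
    assume *: "\<forall>i<length u. q ! min i (length q - 1) = u ! i \<and> Suc (min i (length q - 1)) \<noteq> length q"
    have len: "length u < length q"
    proof (rule ccontr)
      assume "\<not> length u < length q"
      then have "length q - 1 < length u" using pos by linarith
      \<comment> \<open>At this index the shifted position is the last one of the word, which the
        non-maximality atom forbids.\<close>
      with *[rule_format, of "length q - 1"] pos show False by simp
    qed
    have "take (length u) q = u"
    proof (rule nth_equalityI)
      fix i assume "i < length (take (length u) q)"
      then have "i < length u" "min i (length q - 1) = i" using len by auto
      then show "take (length u) q ! i = u ! i" using *[rule_format, of i] by simp
    qed (use len in simp)
    then have "q = u @ drop (length u) q" by (metis append_take_drop_id)
    then show "\<exists>t. t \<noteq> [] \<and> q = u @ t" using len by (metis append_Nil2 less_irrefl)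
  qed (auto simp: nth_append min_def simp flip: length_greater_0_conv)
  finally show ?thesis .
qed

text \<open>Mirror image of the prefix case. Counting positions backwards from the end of
  \<open>q\<close> indexes \<open>rev q\<close>, so the same prefix argument applies to the reversed
  words.\<close>

lemma suffix_hyps_hold_iff:
  assumes "q \<noteq> []"
  shows "(\<forall>h\<in>set (suffix_hyps v). hyp_holds (q @ s) I x (length q) h) \<longleftrightarrow>
    (\<exists>t. t \<noteq> [] \<and> q = t @ v)"
proof -
  have pos: "length q > 0" using assms by simp
  have sh: "shift_pos (length (q @ s)) (length q) (- int i) = length q - min i (length q - 1)" for i
    unfolding length_append using pos by (subst shift_pos_eq; linarith)
  have nth: "(q @ s) ! (length q - min i (length q - 1) - 1) = rev q ! min i (length q - 1)" for i
  proof -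
    have "min i (length q - 1) < length q" "length q - Suc (min i (length q - 1)) < length q"
      using pos by linarith+
    then show ?thesis by (simp add: nth_append rev_nth)
  qed
  have min: "length q - min i (length q - 1) = 1 \<longleftrightarrow> Suc (min i (length q - 1)) = length q" for i
    using pos by linarith
  have "(\<forall>h\<in>set (suffix_hyps v). hyp_holds (q @ s) I x (length q) h) \<longleftrightarrow>
     (\<forall>i<length v. rev q ! min i (length q - 1) = rev v ! i \<and> Suc (min i (length q - 1)) \<noteq> length q)"
    using pos by (auto simp: suffix_hyps_def unary_holds_def sh[simplified] nth[simplified] min[simplified])
  also have "\<dots> \<longleftrightarrow> (\<exists>t. t \<noteq> [] \<and> rev q = rev v @ t)"
  proof
    assume *: "\<forall>i<length v. rev q ! min i (length q - 1) = rev v ! i \<and> Suc (min i (length q - 1)) \<noteq> length q"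
    have len: "length v < length q"
    proof (rule ccontr)
      assume "\<not> length v < length q"
      then have "length q - 1 < length v" using pos by linarith
      with *[rule_format, of "length q - 1"] pos show False by simp
    qed
    have "take (length v) (rev q) = rev v"
    proof (rule nth_equalityI)
      fix i assume "i < length (take (length v) (rev q))"
      then have "i < length v" "min i (length q - 1) = i" using len by auto
      then show "take (length v) (rev q) ! i = rev v ! i" using *[rule_format, of i] by simp
    qed (use len in simp)
    then have "rev q = rev v @ drop (length v) (rev q)" by (metis append_take_drop_id)
    then show "\<exists>t. t \<noteq> [] \<and> rev q = rev v @ t" using len by (metis append_Nil2 length_rev less_irrefl)
  next
    assume "\<exists>t. t \<noteq> [] \<and> rev q = rev v @ t"
    then obtain t where t: "t \<noteq> []" "rev q = rev v @ t" by blast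
    then have "length q = length v + length t" by (metis length_append length_rev)
    moreover have "length t > 0" using t by simp
    ultimately show "\<forall>i<length v. rev q ! min i (length q - 1) = rev v ! i \<and> Suc (min i (length q - 1)) \<noteq> length q"
      by (auto simp: t nth_append min_def simp flip: length_greater_0_conv)
  qed
  also have "\<dots> \<longleftrightarrow> (\<exists>t. t \<noteq> [] \<and> q = t @ v)"
    by (metis rev_append rev_is_Nil_conv rev_rev_ident)
  finally show ?thesis .
qed


text \<open>Relation \<open>0\<close> is equality and \<open>Suc B\<close> stands for the nonterminal \<open>B\<close>.  The atoms \<open>\<not> max(x + i)\<close> and
  \<open>\<not> min(y - i)\<close> in the prefix and suffix hypotheses exclude clamped positions.\<close>
fun conj_hyps :: "'a lconj \<Rightarrow> 'a hyp list" where
  "conj_hyps (NTW u B v) = prefix_hyps u @ suffix_hyps v @ [RelAtom (Suc B) (length u) (length v)]"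
| "conj_hyps (TermW t) = (if t = [] then [EqXY, LtXY]
     else prefix_hyps (butlast t) @ [RelAtom 0 (length t - 1) 0, UAtom True (QSym (last t)) VY 0])"

definition hyps_hold_at :: "(nat \<Rightarrow> (nat \<times> nat) set) \<Rightarrow> 'a list \<Rightarrow> 'a list \<Rightarrow> 'a list \<Rightarrow> 'a hyp list \<Rightarrow> bool" where
  "hyps_hold_at I p z s hs \<longleftrightarrow>
     (\<forall>h\<in>set hs. hyp_holds (p @ z @ s) I (Suc (length p)) (length p + length z) h)"

lemma hyps_hold_at_append [simp]:
  "hyps_hold_at I p z s (hs @ hs') \<longleftrightarrow> hyps_hold_at I p z s hs \<and> hyps_hold_at I p z s hs'"
  by (auto simp: hyps_hold_at_def)

lemma hyps_hold_at_concat [simp]: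
  "hyps_hold_at I p z s (concat hss) \<longleftrightarrow> (\<forall>hs\<in>set hss. hyps_hold_at I p z s hs)"
  by (auto simp: hyps_hold_at_def)

lemma hyps_hold_at_prefix:
  "z \<noteq> [] \<Longrightarrow> hyps_hold_at I p z s (prefix_hyps u) \<longleftrightarrow> (\<exists>t. t \<noteq> [] \<and> z @ s = u @ t)"
  unfolding hyps_hold_at_def by (rule prefix_hyps_hold_iff) simp

lemma hyps_hold_at_suffix:
  "z \<noteq> [] \<Longrightarrow> hyps_hold_at I p z s (suffix_hyps v) \<longleftrightarrow> (\<exists>t. t \<noteq> [] \<and> p @ z = t @ v)"
  using suffix_hyps_hold_iff[of "p @ z" v s I] by (simp add: hyps_hold_at_def)

text \<open>The prefix and suffix hypotheses alone would let \<open>u\<close> run into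
  \<open>s\<close> and \<open>v\<close> into \<open>p\<close>, or let them overlap. The ordering
  guard of the relational atom confines both to \<open>z\<close> and leaves a nonempty middle
  \<open>m\<close>.\<close>

lemma hyps_hold_at_NTW:
  assumes "z \<noteq> []"
  shows "hyps_hold_at I p z s (conj_hyps (NTW u B v)) \<longleftrightarrow>
    (\<exists>m. m \<noteq> [] \<and> z = u @ m @ v \<and> (Suc (length (p @ u)), length (p @ u) + length m) \<in> I (Suc B))"
    (is "?L \<longleftrightarrow> ?R")
proof
  assume L: ?L
  then obtain t1 t2 where t: "t1 \<noteq> []" "z @ s = u @ t1" "t2 \<noteq> []" "p @ z = t2 @ v"
    using assms by (auto simp: hyps_hold_at_prefix hyps_hold_at_suffix)
  then have "length z + length s = length u + length t1" "length p + length z = length t2 + length v"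
    "length t1 > 0" "length t2 > 0" "length z > 0"
    using assms by (metis length_append length_greater_0_conv)+
  \<comment> \<open>The letters found after \<open>u\<close> and before \<open>v\<close> show that
    neither displacement is clamped.\<close>
  then have min: "min (length u) (length z - 1 + length s) = length u"
    "min (length v) (length p + length z - 1) = length v" by linarith+
  then have rel: "length u + length v < length z"
    "(Suc (length p + length u), length p + length z - length v) \<in> I (Suc B)"
    using L assms by (auto simp: hyps_hold_at_def hyp_holds_RelAtom_iff simp del: hyp_holds.simps)
  have "take (length u) (z @ s) = u" "drop (length p + length z - length v) (p @ z) = v"
    using t \<open>length p + length z = _\<close> by simp_all
  then have u: "take (length u) z = u" and v: "drop (length z - length v) z = v"
    using rel(1) by simp_all
  define m where "m = take (length z - length v - length u) (drop (length u) z)"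
  have z: "z = u @ m @ v"
  proof -
    have "z = take (length z - length v) z @ v" using v by (metis append_take_drop_id)
    also have "take (length z - length v) z = take (length u) z @ m"
      using rel(1) by (simp add: m_def take_add[symmetric])
    finally show ?thesis using u by simp
  qed
  moreover have "m \<noteq> []" using rel(1) z by auto
  moreover have "(Suc (length (p @ u)), length (p @ u) + length m) \<in> I (Suc B)"
    using rel(2) z by (simp add: add.assoc)
  ultimately show ?R by blast
next
  assume ?R
  then obtain m where m: "m \<noteq> []" "z = u @ m @ v"
    "(Suc (length (p @ u)), length (p @ u) + length m) \<in> I (Suc B)" by blast
  have "length z = length u + length m + length v" "length m > 0" using m by simp_all
  then have len: "min (length u) (length z - 1 + length s) = length u"
    "min (length v) (length p + length z - 1) = length v"
    "length u + length v < length z"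
    "length p + length z - length v = length p + length u + length m" by linarith+
  have "hyp_holds (p @ z @ s) I (Suc (length p)) (length p + length z) (RelAtom (Suc B) (length u) (length v))"
    unfolding hyp_holds_RelAtom_iff[OF assms] len(1,2) using m(3) len(3,4) by simp
  moreover have "\<exists>t. t \<noteq> [] \<and> z @ s = u @ t" using m by (intro exI[of _ "m @ v @ s"]) simp
  moreover have "\<exists>t. t \<noteq> [] \<and> p @ z = t @ v" using m by (intro exI[of _ "p @ u @ m"]) simp
  ultimately show ?L using assms
    by (simp add: hyps_hold_at_prefix hyps_hold_at_suffix del: hyp_holds.simps) (simp add: hyps_hold_at_def)
qed

lemma hyp_holds_last_letter:
  "z \<noteq> [] \<Longrightarrow> hyp_holds (p @ z @ s) I x (length p + length z) (UAtom True (QSym a) VY 0) \<longleftrightarrow> last z = a"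
  by (cases z rule: rev_cases) (auto simp: unary_holds_def shift_pos_def nth_append)

text \<open>Relation \<open>0\<close> at \<open>x + (length t - 1)\<close> and \<open>y\<close>
  fixes the length of the factor. The last letter is read at \<open>y\<close> because a prefix
  hypothesis for it would demand a further letter, which is missing when the factor ends the word.
  Here relation \<open>0\<close> only has to contain the diagonal, as it does in every
  model.\<close>

lemma hyps_hold_at_TermW_I:
  assumes "z \<noteq> []" "\<And>x. 1 \<le> x \<Longrightarrow> x \<le> length (p @ z @ s) \<Longrightarrow> (x, x) \<in> I 0"
  shows "hyps_hold_at I p z s (conj_hyps (TermW z))"
proof -
  obtain k where k: "length z = Suc k" using assms(1) by (cases "length z") auto
  have "hyp_holds (p @ z @ s) I (Suc (length p)) (length p + length z) (RelAtom 0 (length z - 1) 0)"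
    unfolding hyp_holds_RelAtom_iff[OF assms(1)] using assms(2)[of "length p + length z"] by (simp add: k)
  moreover have "hyp_holds (p @ z @ s) I (Suc (length p)) (length p + length z) (UAtom True (QSym (last z)) VY 0)"
    using hyp_holds_last_letter[OF assms(1)] by blast
  moreover have "z @ s = butlast z @ last z # s"
    using assms(1) by (metis append.assoc append_Cons append_Nil append_butlast_last_id)
  then have "\<exists>t. t \<noteq> [] \<and> z @ s = butlast z @ t" by blast
  ultimately show ?thesis
    using assms(1)
    by (simp add: hyps_hold_at_prefix del: hyp_holds.simps) (simp add: hyps_hold_at_def del: hyp_holds.simps)
qed

text \<open>The converse direction relies on relation \<open>0\<close> lying inside the diagonal,
  which holds in the model chosen for \<open>grammar_horn_sound\<close>.\<close>

lemma hyps_hold_at_TermW_D: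
  assumes "z \<noteq> []" "\<And>x y. (x, y) \<in> I 0 \<Longrightarrow> x = y" and L: "hyps_hold_at I p z s (conj_hyps (TermW t))"
  shows "z = t"
proof -
  \<comment> \<open>For empty \<open>t\<close> the hypotheses are \<open>EqXY\<close> and
    \<open>LtXY\<close>, which contradict each other.\<close>
  have "t \<noteq> []" using L by (auto simp: hyps_hold_at_def)
  with L assms(1) obtain r where r: "r \<noteq> []" "z @ s = butlast t @ r" by (auto simp: hyps_hold_at_prefix)
  have "last z = last t"
    using L \<open>t \<noteq> []\<close> hyp_holds_last_letter[OF assms(1)] by (simp add: hyps_hold_at_def del: hyp_holds.simps)
  have "length z + length s = length t - 1 + length r" using r by (metis length_append length_butlast)
  moreover have "length r > 0" "length z > 0" "length t > 0" using r assms \<open>t \<noteq> []\<close> by auto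
  ultimately have min: "min (length t - 1) (length z - 1 + length s) = length t - 1" by linarith
  have "hyp_holds (p @ z @ s) I (Suc (length p)) (length p + length z) (RelAtom 0 (length t - 1) 0)"
    using L \<open>t \<noteq> []\<close> by (simp add: hyps_hold_at_def del: hyp_holds.simps)
  then have "(Suc (length p + (length t - 1)), length p + length z) \<in> I 0"
    unfolding hyp_holds_RelAtom_iff[OF assms(1)] min by simp
  then have "length z = length t" using assms(2) \<open>length t > 0\<close> by fastforce
  moreover have "take (length t - 1) (z @ s) = butlast t" using r by simp
  ultimately have "butlast z = butlast t" by (simp add: butlast_conv_take)
  with \<open>last z = last t\<close> show ?thesis
    using assms(1) \<open>t \<noteq> []\<close> by (metis append_butlast_last_id)
qed

text \<open>A relation only speaks about nonempty factors, hence the extra alternative when \<open>B\<close> derives the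
  empty word (\<open>E\<close> is the set of such \<open>B\<close>).\<close>
fun conj_alts :: "nat set \<Rightarrow> 'a lconj \<Rightarrow> 'a lconj list" where
  "conj_alts E (TermW t) = [TermW t]"
| "conj_alts E (NTW u B v) = NTW u B v # (if B \<in> E then [TermW (u @ v)] else [])"

section \<open>The formula of a grammar and its correctness\<close>

text \<open>A clause body has no disjunction, so every choice of one alternative per conjunct
  becomes a clause of its own.\<close>

definition rule_clauses :: "nat set \<Rightarrow> nat \<times> 'a lconj list \<Rightarrow> 'a clause list" where
  "rule_clauses E r = map (\<lambda>ds. (concat (map conj_hyps ds), HeadRel (Suc (fst r))))
     (product_lists (map (conj_alts E) (snd r)))"

definition grammar_horn :: "'a lcg_rules \<Rightarrow> nat \<Rightarrow> 'a incl_horn" where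
  "grammar_horn P S = ([EqXY], HeadRel 0) #
     ([UAtom True MinSym VX 0, UAtom True MaxSym VY 0, RelAtom (Suc S) 0 0], HeadBot) #
     concat (map (rule_clauses {B. [] \<in> lcg_lang P B}) P)"

text \<open>The intended interpretation is a model: a satisfied body places the factor in every
  conjunct of the rule, hence in the language of its left-hand side. The \<open>HeadBot\<close>
  clause could fire only at the ends of the word, which would put \<open>w\<close> in the language
  of \<open>S\<close>.\<close>

lemma grammar_horn_sound:
  fixes w :: "'a list"
  assumes "w \<notin> lcg_lang P S"
  shows "incl_horn_models w (grammar_horn P S)"
proof -
  define I where "I = (\<lambda>R. case R of 0 \<Rightarrow> {(x, x) | x. x \<in> {1..length w}}
    | Suc A \<Rightarrow> spans w (\<lambda>_ z _. z \<in> lcg_lang P A))"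
  have I0: "\<And>x y. (x, y) \<in> I 0 \<Longrightarrow> x = y" by (auto simp: I_def)
  have sub: "I R \<subseteq> {1..length w} \<times> {1..length w}" for R
    by (cases R) (auto simp: I_def dest: subsetD[OF spans_subset])
  have lang: "z \<in> conj_lang (lcg_lang P) c"
    if w: "w = p @ z @ s" "z \<noteq> []" and d: "d \<in> set (conj_alts {B. [] \<in> lcg_lang P B} c)"
      and h: "hyps_hold_at I p z s (conj_hyps d)" for p z s c d
  proof (cases d)
    case (TermW t)
    with hyps_hold_at_TermW_D[OF w(2) I0] h have "z = t" by blast
    then show ?thesis using d TermW by (cases c) (auto split: if_splits)
  next
    case (NTW u B v)
    with h w obtain m where m: "m \<noteq> []" "z = u @ m @ v"
      "(Suc (length (p @ u)), length (p @ u) + length m) \<in> I (Suc B)"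
      unfolding NTW hyps_hold_at_NTW[OF w(2)] by blast
    moreover have "w = (p @ u) @ m @ (v @ s)" using w m by simp
    ultimately have "m \<in> lcg_lang P B" using spans_iff[OF m(1), of "p @ u" "v @ s"] by (simp add: I_def)
    then show ?thesis using d NTW m by (cases c) (auto split: if_splits)
  qed
  have "clause_holds w I x y c"
    if xy: "x \<in> {1..length w}" "y \<in> {1..length w}" and c: "c \<in> set (grammar_horn P S)" for x y c
    unfolding clause_holds_def
  proof (intro impI, elim conjE)
    assume "x \<le> y" and hyps: "\<forall>h\<in>set (fst c). hyp_holds w I x y h"
    have "1 \<le> x" "y \<le> length w" using xy by auto
    from this(1) \<open>x \<le> y\<close> this(2) obtain p z s
      where w: "w = p @ z @ s" "z \<noteq> []" "x = Suc (length p)" "y = length p + length z"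
      by (rule interval_split)
    have hold: "hyps_hold_at I p z s (fst c)" using hyps w by (simp add: hyps_hold_at_def)
    consider "c = ([EqXY], HeadRel 0)"
      | "c = ([UAtom True MinSym VX 0, UAtom True MaxSym VY 0, RelAtom (Suc S) 0 0], HeadBot)"
      | A cs where "(A, cs) \<in> set P" "c \<in> set (rule_clauses {B. [] \<in> lcg_lang P B} (A, cs))"
      using c by (auto simp: grammar_horn_def)
    then show "head_holds I x y (snd c)"
    proof cases
      case 1
      then show ?thesis using hyps xy by (auto simp: I_def)
    next
      case 2
      then have "x = 1" "y = length w" using hyps by (auto simp: unary_holds_def shift_pos_def)
      then have "p = []" "s = []" using w by auto
      have "(x, y) \<in> I (Suc S)" using hyps 2 by (auto simp: shift_pos_def)
      then have "z \<in> lcg_lang P S" using spans_iff[OF w(2), of p s] w by (simp add: I_def)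
      then show ?thesis using assms w \<open>p = []\<close> \<open>s = []\<close> by simp
    next
      case 3
      then obtain ds where ds: "list_all2 (\<lambda>d c. d \<in> set (conj_alts {B. [] \<in> lcg_lang P B} c)) ds cs"
        "c = (concat (map conj_hyps ds), HeadRel (Suc A))"
        by (auto simp: rule_clauses_def product_lists_set list_all2_map2)
      have "z \<in> conj_lang (lcg_lang P) c'" if "c' \<in> set cs" for c'
      proof -
        obtain i where i: "i < length cs" "c' = cs ! i" using \<open>c' \<in> set cs\<close> by (auto simp: in_set_conv_nth)
        define d where "d = ds ! i"
        have d: "d \<in> set ds" "d \<in> set (conj_alts {B. [] \<in> lcg_lang P B} c')"
          using i list_all2_lengthD[OF ds(1)] list_all2_nthD2[OF ds(1) i(1)] by (simp_all add: d_def)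
        have "hyps_hold_at I p z s (conj_hyps d)" using hold ds(2) d(1) by simp
        then show ?thesis by (rule lang[OF w(1,2) d(2)])
      qed
      with 3(1) have "z \<in> lcg_lang P A" by (rule lcg_lang_intro)
      then show ?thesis using spans_iff[OF w(2), of p s] w ds(2) by (simp add: I_def)
    qed
  qed
  with sub show ?thesis unfolding incl_horn_models_def by blast
qed

text \<open>By induction on derivations, any model must contain the pair of end positions of every
  derived nonempty factor of \<open>w\<close>. Applied to \<open>w\<close> and \<open>S\<close> this
  triggers the \<open>HeadBot\<close> clause.\<close>

lemma grammar_horn_complete:
  fixes w :: "'a list"
  assumes "w \<in> lcg_lang P S" "w \<noteq> []"
  shows "\<not> incl_horn_models w (grammar_horn P S)"
proof
  define E where "E = {B. [] \<in> lcg_lang P B}"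
  assume "incl_horn_models w (grammar_horn P S)"
  then obtain I where
    clauses: "\<And>x y c. x \<in> {1..length w} \<Longrightarrow> y \<in> {1..length w} \<Longrightarrow> c \<in> set (grammar_horn P S) \<Longrightarrow> clause_holds w I x y c"
    unfolding incl_horn_models_def by blast
  have clause: "head_holds I (Suc (length p)) (length p + length z) h"
    if "w = p @ z @ s" "z \<noteq> []" "(hs, h) \<in> set (grammar_horn P S)" "hyps_hold_at I p z s hs" for p z s hs h
  proof -
    have "Suc 0 \<le> length z" using that by (simp add: Suc_le_eq)
    then show ?thesis
      using clauses[of "Suc (length p)" "length p + length z" "(hs, h)"] that
      by (auto simp: clause_holds_def hyps_hold_at_def)
  qed
  have I0: "(x, x) \<in> I 0" if "1 \<le> x" "x \<le> length w" for x
    using clauses[of x x "([EqXY], HeadRel 0)"] that by (auto simp: clause_holds_def grammar_horn_def)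
  \<comment> \<open>The invariant covers all occurrences of a nonempty factor in \<open>w\<close>.
    Relations say nothing about the empty word, so there it records the language itself.\<close>
  define X where "X = (\<lambda>A. {z. if z = [] then [] \<in> lcg_lang P A
    else \<forall>p s. w = p @ z @ s \<longrightarrow> (Suc (length p), length p + length z) \<in> I (Suc A)})"
  have "lcg_lang P S \<subseteq> X S"
  proof (rule lcg_lang_least)
    fix A cs z
    assume rule: "(A, cs) \<in> set P" and z: "\<And>c. c \<in> set cs \<Longrightarrow> z \<in> conj_lang X c"
    show "z \<in> X A"
    proof (cases "z = []")
      case True
      \<comment> \<open>For the empty word a conjunct \<open>u B v\<close> has empty
        \<open>u\<close>, \<open>v\<close> and middle, where \<open>X\<close> agrees with the
        language.\<close>
      have "z \<in> conj_lang (lcg_lang P) c" if "c \<in> set cs" for c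
        using z[OF that] True by (cases c) (auto simp: X_def)
      with rule have "z \<in> lcg_lang P A" by (rule lcg_lang_intro)
      then show ?thesis using True by (simp add: X_def)
    next
      case False
      have "(Suc (length p), length p + length z) \<in> I (Suc A)" if w: "w = p @ z @ s" for p s
      proof -
        \<comment> \<open>The alternative depends on the middle: the terminal one if it is empty,
          the relational one otherwise.\<close>
        have "\<exists>d. d \<in> set (conj_alts E c) \<and> hyps_hold_at I p z s (conj_hyps d)" if "c \<in> set cs" for c
        proof -
          have termw: "hyps_hold_at I p z s (conj_hyps (TermW z))"
            using hyps_hold_at_TermW_I[where p = p and s = s and I = I] False I0 w by auto
          show ?thesis
          proof (cases c)
            case (TermW t)
            then show ?thesis using z[OF that] termw by auto
          next
            case (NTW u B v)
            with z[OF that] have "\<exists>m. z = u @ m @ v \<and> m \<in> X B" by simp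
            then obtain m where m: "z = u @ m @ v" "m \<in> X B" by blast
            show ?thesis
            proof (cases "m = []")
              case True
              then show ?thesis
                unfolding NTW using m termw
                by (intro exI[of _ "TermW (u @ v)"]) (simp add: X_def E_def del: conj_hyps.simps)
            next
              case False
              have "w = (p @ u) @ m @ (v @ s)" using w m(1) by simp
              moreover from m(2) False
              have "\<forall>p s. w = p @ m @ s \<longrightarrow> (Suc (length p), length p + length m) \<in> I (Suc B)"
                by (simp add: X_def)
              ultimately have "(Suc (length (p @ u)), length (p @ u) + length m) \<in> I (Suc B)" by blast
              with m(1) False have "\<exists>m. m \<noteq> [] \<and> z = u @ m @ v \<and>
                  (Suc (length (p @ u)), length (p @ u) + length m) \<in> I (Suc B)" by blast
              then have "hyps_hold_at I p z s (conj_hyps (NTW u B v))"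
                unfolding hyps_hold_at_NTW[OF \<open>z \<noteq> []\<close>] .
              then show ?thesis
                unfolding NTW by (intro exI[of _ "NTW u B v"]) (simp del: conj_hyps.simps)
            qed
          qed
        qed
        then obtain f where f: "\<And>c. c \<in> set cs \<Longrightarrow> f c \<in> set (conj_alts E c) \<and> hyps_hold_at I p z s (conj_hyps (f c))"
          by metis
        have "map f cs \<in> set (product_lists (map (conj_alts E) cs))"
          using f by (auto simp: product_lists_set list_all2_map1 list_all2_map2 intro!: list.rel_refl_strong)
        then have "(concat (map conj_hyps (map f cs)), HeadRel (Suc A)) \<in> set (rule_clauses E (A, cs))"
          unfolding rule_clauses_def by force
        then have "(concat (map conj_hyps (map f cs)), HeadRel (Suc A)) \<in> set (grammar_horn P S)"
          using rule unfolding grammar_horn_def E_def by auto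
        from clause[OF w False this] f show ?thesis by auto
      qed
      then show ?thesis using False by (simp add: X_def)
    qed
  qed
  with assms(1) have "w \<in> X S" by blast
  with assms(2) have "\<forall>p s. w = p @ w @ s \<longrightarrow> (Suc (length p), length p + length w) \<in> I (Suc S)"
    by (simp add: X_def)
  from this[rule_format, of "[]" "[]"] have "(Suc 0, length w) \<in> I (Suc S)" by simp
  then have "hyps_hold_at I [] w [] [UAtom True MinSym VX 0, UAtom True MaxSym VY 0, RelAtom (Suc S) 0 0]"
    using assms(2) by (auto simp: hyps_hold_at_def unary_holds_def shift_pos_def Suc_le_eq)
  from clause[OF _ assms(2) _ this, of HeadBot] show False by (simp add: grammar_horn_def)
qed

subsection \<open>From inclusion Horn formulas to grammars\<close>

definition lastn :: "nat \<Rightarrow> 'a list \<Rightarrow> 'a list" where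
  "lastn K p = drop (length p - K) p"

lemma length_lastn [simp]: "length (lastn K p) = min K (length p)"
  by (simp add: lastn_def)

lemma lastn_Nil [simp]: "lastn K [] = []"
  by (simp add: lastn_def)

lemma lastn_append: "lastn K (p @ q) = lastn K (lastn K p @ q)"
  by (cases "length p \<le> K") (auto simp: lastn_def add.commute)

lemma lastn_append_long: "K \<le> length q \<Longrightarrow> lastn K (p @ q) = lastn K q"
  by (simp add: lastn_def)

lemma take_append_take: "take K (q @ s) = take K (q @ take K s)"
  by simp

lemma lastn_append_cong: "lastn K p = lastn K p' \<Longrightarrow> lastn K (p @ q) = lastn K (p' @ q)"
  by (metis lastn_append)

lemma take_append_cong: "take K s = take K s' \<Longrightarrow> take K (q @ s) = take K (q @ s')"
  by (metis take_append_take)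

definition clamp_pos :: "nat \<Rightarrow> int \<Rightarrow> nat" where
  "clamp_pos n t = nat (max 1 (min (int n) t))"

text \<open>The offset \<open>j\<close> is counted from the first letter after the cut between
  \<open>L\<close> and \<open>R\<close>. If something nonempty is removed on a side, the remaining
  block there has \<open>K\<close> letters and the position stays strictly inside it, so neither
  clamping nor a test for that end notices the removal. A side from which nothing is removed keeps
  its true end.\<close>

lemma unary_holds_truncate:
  assumes "P0 = [] \<or> length L = K" "T0 = [] \<or> length R = K" "\<bar>j\<bar> + 1 < int K" "P0 @ L @ R @ T0 \<noteq> []"
  shows "unary_holds (P0 @ L @ R @ T0) U (clamp_pos (length (P0 @ L @ R @ T0)) (int (length (P0 @ L)) + 1 + j)) \<longleftrightarrow>
    unary_holds (L @ R) U (clamp_pos (length (L @ R)) (int (length L) + 1 + j))"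
proof -
  define i where "i = clamp_pos (length (L @ R)) (int (length L) + 1 + j)"
  have ne: "length L + length R > 0" using assms by (cases "P0 = []"; cases "T0 = []") auto
  then have i: "1 \<le> i" "i \<le> length L + length R"
    unfolding i_def clamp_pos_def length_append by linarith+
  have "clamp_pos (length (P0 @ L @ R @ T0)) (int (length (P0 @ L)) + 1 + j) = length P0 + i"
  proof (cases "P0 = []"; cases "T0 = []")
    assume "P0 = []" "T0 = []"
    then show ?thesis by (simp add: i_def)
  next
    assume "P0 = []" "T0 \<noteq> []"
    then have "length R = K" using assms(2) by simp
    then have "int (length L) + 1 + j \<le> int (length (L @ R))" using assms(3) by simp
    then show ?thesis using \<open>P0 = []\<close> unfolding i_def clamp_pos_def length_append by simp
  next
    assume "P0 \<noteq> []" "T0 = []"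
    then have "length L = K" using assms(1) by simp
    then show ?thesis using assms(3) \<open>T0 = []\<close> unfolding i_def clamp_pos_def length_append by simp
  next
    assume "P0 \<noteq> []" "T0 \<noteq> []"
    then have "length L = K" "length R = K" using assms(1,2) by simp_all
    then show ?thesis using assms(3) unfolding i_def clamp_pos_def length_append by simp
  qed
  moreover have "(P0 @ L @ R @ T0) ! (length P0 + i - 1) = (L @ R) ! (i - 1)"
  proof -
    have "length P0 + i - 1 = length P0 + (i - 1)" "i - 1 < length (L @ R)" using i by auto
    then show ?thesis by (metis append.assoc nth_append nth_append_length_plus)
  qed
  moreover have "length P0 + i = 1 \<longleftrightarrow> i = 1"
  proof (cases "P0 = []")
    case False
    then have "i > 1" using assms ne unfolding i_def clamp_pos_def length_append by linarith
    then show ?thesis by simp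
  qed simp
  moreover have "length P0 + i = length (P0 @ L @ R @ T0) \<longleftrightarrow> i = length (L @ R)"
  proof (cases "T0 = []")
    case False
    then have "i < length (L @ R)" using assms ne unfolding i_def clamp_pos_def length_append by linarith
    then show ?thesis by simp
  qed simp
  ultimately show ?thesis unfolding i_def[symmetric] unary_holds_def by (simp split: unary_sym.split)
qed

text \<open>Both words are compared with their common truncation around the cut,
  \<open>lastn K P @ take K T\<close>.\<close>

lemma unary_holds_local:
  assumes "lastn K P = lastn K P'" "take K T = take K T'" "\<bar>j\<bar> + 1 < int K" "P @ T \<noteq> []" "P' @ T' \<noteq> []"
  shows "unary_holds (P @ T) U (clamp_pos (length (P @ T)) (int (length P) + 1 + j)) \<longleftrightarrow>
    unary_holds (P' @ T') U (clamp_pos (length (P' @ T')) (int (length P') + 1 + j))"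
proof -
  have "unary_holds (P @ T) U (clamp_pos (length (P @ T)) (int (length P) + 1 + j)) \<longleftrightarrow>
     unary_holds (lastn K P @ take K T) U
       (clamp_pos (length (lastn K P @ take K T)) (int (length (lastn K P)) + 1 + j))"
    if "P @ T \<noteq> []" for P T
  proof -
    have w: "take (length P - K) P @ lastn K P @ take K T @ drop K T = P @ T"
      "take (length P - K) P @ lastn K P = P"
      by (simp_all add: lastn_def flip: append.assoc)
    have c: "take (length P - K) P = [] \<or> length (lastn K P) = K"
      "drop K T = [] \<or> length (take K T) = K" by auto
    show ?thesis
      using unary_holds_truncate[OF c assms(3), of U] that unfolding w by blast
  qed
  from this[OF assms(4)] this[OF assms(5)] show ?thesis unfolding assms(1,2) by blast
qed

text \<open>For \<open>VX\<close> the cut lies before \<open>z\<close>, for \<open>VY\<close> after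
  it. Position y is the last letter left of its cut, so its offset is \<open>a - 1\<close>; this is
  why \<open>K\<close> has to exceed \<bar>a\<bar> + 2.\<close>

lemma hyp_holds_UAtom_local:
  assumes "lastn K p = lastn K p'" "take K (z @ s) = take K (z' @ s')"
    and "lastn K (p @ z) = lastn K (p' @ z')" "take K s = take K s'"
    and "z \<noteq> []" "z' \<noteq> []" "\<bar>a\<bar> + 2 < int K"
  shows "hyp_holds (p @ z @ s) I (Suc (length p)) (length p + length z) (UAtom b U v a) \<longleftrightarrow>
    hyp_holds (p' @ z' @ s') I' (Suc (length p')) (length p' + length z') (UAtom b U v a)"
proof (cases v)
  case VX
  have "shift_pos (length (p @ z @ s)) (Suc (length p)) a = clamp_pos (length (p @ z @ s)) (int (length p) + 1 + a)"
    if "z \<noteq> []" for p z s :: "'a list"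
    using that by (subst shift_pos_eq) (simp_all add: clamp_pos_def Suc_le_eq)
  note shift = this
  have "unary_holds (p @ z @ s) U (clamp_pos (length (p @ z @ s)) (int (length p) + 1 + a)) \<longleftrightarrow>
    unary_holds (p' @ z' @ s') U (clamp_pos (length (p' @ z' @ s')) (int (length p') + 1 + a))"
    by (rule unary_holds_local[OF assms(1,2)]) (use assms(5-7) in auto)
  then show ?thesis by (simp only: VX hyp_holds.simps var.case shift[OF assms(5)] shift[OF assms(6)])
next
  case VY
  have "shift_pos (length (p @ z @ s)) (length p + length z) a
      = clamp_pos (length ((p @ z) @ s)) (int (length (p @ z)) + 1 + (a - 1))"
    if "z \<noteq> []" for p z s :: "'a list"
    using that by (subst shift_pos_eq) (simp_all add: clamp_pos_def Suc_le_eq)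
  note shift = this
  have "unary_holds ((p @ z) @ s) U (clamp_pos (length ((p @ z) @ s)) (int (length (p @ z)) + 1 + (a - 1))) \<longleftrightarrow>
    unary_holds ((p' @ z') @ s') U (clamp_pos (length ((p' @ z') @ s')) (int (length (p' @ z')) + 1 + (a - 1)))"
    by (rule unary_holds_local[OF assms(3,4)]) (use assms(5-7) in auto)
  then show ?thesis
    by (simp only: VY hyp_holds.simps var.case shift[OF assms(5)] shift[OF assms(6)] append.assoc)
qed

lemma hyp_holds_RelAtom_split:
  assumes "z = u @ m @ v" "m \<noteq> []"
    and "length u = min a (length z - 1 + length s)" "length v = min b (length p + length z - 1)"
  shows "hyp_holds (p @ z @ s) I (Suc (length p)) (length p + length z) (RelAtom S a b) \<longleftrightarrow>
    (Suc (length (p @ u)), length (p @ u) + length m) \<in> I S"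
proof -
  have "z \<noteq> []" using assms(1,2) by simp
  have "length u + length v < length z" "length p + length z - length v = length (p @ u) + length m"
    using assms(1,2) by simp_all
  then show ?thesis
    unfolding hyp_holds_RelAtom_iff[OF \<open>z \<noteq> []\<close>] assms(3,4)[symmetric] by simp
qed

text \<open>Either \<open>m = m'\<close>, or both are at least \<open>K\<close> and so exceed
  \<open>a\<close>. Thus clamped displacements depend only on the lengths of truncated
  contexts.\<close>

lemma min_add_cong:
  fixes K m m' a k :: nat
  assumes "min K m = min K m'" "a < K"
  shows "min a (k + m) = min a (k + m')"
  using assms by (auto simp: min_def split: if_splits)

section \<open>Rules over truncated contexts\<close>

instance head :: countable
  by countable_datatype

text \<open>\<open>Some (h, l, r)\<close> describes the factors at which \<open>h\<close> is forced, among the occurrences whose left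
  and right contexts truncated to length \<open>K\<close> are \<open>l\<close> and \<open>r\<close>; \<open>None\<close> stands for all words.\<close>
type_synonym 'a ctx_nt = "(head \<times> 'a list \<times> 'a list) option"

definition horn_model :: "'a incl_horn \<Rightarrow> 'a list \<Rightarrow> (nat \<Rightarrow> (nat \<times> nat) set) \<Rightarrow> bool" where
  "horn_model \<Phi> w I \<longleftrightarrow> (\<forall>x\<in>{1..length w}. \<forall>y\<in>{1..length w}. \<forall>c\<in>set \<Phi>. clause_holds w I x y c)"

lemma horn_modelD:
  assumes "horn_model \<Phi> (p @ z @ s) I" "z \<noteq> []" "(hs, h) \<in> set \<Phi>" "hyps_hold_at I p z s hs"
  shows "head_holds I (Suc (length p)) (length p + length z) h"
proof -
  have "Suc 0 \<le> length z" using assms(2) by (simp add: Suc_le_eq)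
  then have "clause_holds (p @ z @ s) I (Suc (length p)) (length p + length z) (hs, h)"
    using assms(1,3) unfolding horn_model_def by auto
  then show ?thesis using assms(4) \<open>Suc 0 \<le> length z\<close> by (simp add: clause_holds_def hyps_hold_at_def)
qed

text \<open>Meaning of a nonterminal relative to one interpretation of one word. A nonempty word
  without an occurrence in the given contexts belongs vacuously.\<close>

definition ctx_lang :: "nat \<Rightarrow> 'a list \<Rightarrow> (nat \<Rightarrow> (nat \<times> nat) set) \<Rightarrow> 'a ctx_nt \<Rightarrow> 'a list set" where
  "ctx_lang K w I N = (case N of None \<Rightarrow> UNIV | Some (h, l, r) \<Rightarrow>
     {z. z \<noteq> [] \<and> (\<forall>p s. w = p @ z @ s \<longrightarrow> lastn K p = l \<longrightarrow> take K s = r \<longrightarrow>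
       head_holds I (Suc (length p)) (length p + length z) h)})"

lemma ctx_lang_SomeD:
  assumes "z \<in> ctx_lang K (p @ z @ s) I (Some (h, lastn K p, take K s))"
  shows "head_holds I (Suc (length p)) (length p + length z) h"
  using assms by (auto simp: ctx_lang_def)

text \<open>This says that the rule preserves \<open>ctx_lang\<close> in all models of all words at
  once, the numbers being decoded by \<open>from_nat\<close>.\<close>

definition sound_rule :: "nat \<Rightarrow> 'a::finite incl_horn \<Rightarrow> 'a ctx_nt \<Rightarrow> 'a lconj list \<Rightarrow> bool" where
  "sound_rule K \<Phi> N cs \<longleftrightarrow> (\<forall>w I z. horn_model \<Phi> w I \<longrightarrow>
     (\<forall>c\<in>set cs. z \<in> conj_lang (\<lambda>n. ctx_lang K w I (from_nat n)) c) \<longrightarrow> z \<in> ctx_lang K w I N)"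

definition ctx_heads :: "nat \<Rightarrow> head set" where
  "ctx_heads K = insert HeadBot (HeadRel ` {..<K})"

definition ctx_nts :: "nat \<Rightarrow> 'a ctx_nt set" where
  "ctx_nts K = insert None (Some ` (ctx_heads K \<times> {l. length l \<le> K} \<times> {r. length r \<le> K}))"

definition ctx_conjs :: "nat \<Rightarrow> 'a::finite lconj set" where
  "ctx_conjs K = TermW ` {t. length t \<le> 2 * K} \<union>
     (\<lambda>(u, N, v). NTW u (to_nat N) v) ` ({u. length u \<le> K} \<times> (ctx_nts K :: 'a ctx_nt set) \<times> {v. length v \<le> K})"

text \<open>Taking every rule of bounded size that is correct in all models makes soundness immediate,
  so that only the rules needed for completeness have to be examined.\<close>
definition ctx_rules :: "nat \<Rightarrow> 'a::finite incl_horn \<Rightarrow> (nat \<times> 'a lconj list) set" where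
  "ctx_rules K \<Phi> = {(to_nat N, cs) | N cs. N \<in> ctx_nts K \<and> set cs \<subseteq> ctx_conjs K \<and> length cs \<le> K \<and>
     cs \<noteq> [] \<and> sound_rule K \<Phi> N cs}"

lemma finite_ctx_rules: "finite (ctx_rules K \<Phi>)"
proof -
  have lists: "finite {l :: 'a list. length l \<le> n}" for n
    using finite_lists_length_le[of "UNIV :: 'a set" n] by simp
  have nts: "finite (ctx_nts K :: 'a ctx_nt set)"
    unfolding ctx_nts_def ctx_heads_def by (intro finite.insertI finite_imageI finite_cartesian_product lists) auto
  have conjs: "finite (ctx_conjs K :: 'a lconj set)"
    unfolding ctx_conjs_def by (intro finite_UnI finite_imageI finite_cartesian_product lists nts)
  have "ctx_rules K \<Phi> \<subseteq> to_nat ` (ctx_nts K :: 'a ctx_nt set) \<times> {cs. set cs \<subseteq> ctx_conjs K \<and> length cs \<le> K}"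
    unfolding ctx_rules_def by blast
  then show ?thesis
    by (rule finite_subset) (intro finite_cartesian_product finite_imageI nts finite_lists_length_le conjs)
qed

text \<open>By the choice of the rules, \<open>ctx_lang\<close> is closed under all of them, so the
  least solution lies below it.\<close>

lemma lcg_lang_ctx_sound:
  assumes "set P = ctx_rules K \<Phi>" "horn_model \<Phi> w I"
  shows "lcg_lang P (to_nat N) \<subseteq> ctx_lang K w I N"
proof -
  have "lcg_lang P n \<subseteq> ctx_lang K w I (from_nat n)" for n
  proof (rule lcg_lang_least)
    fix A cs z
    assume "(A, cs) \<in> set P" and z: "\<And>c. c \<in> set cs \<Longrightarrow> z \<in> conj_lang (\<lambda>n. ctx_lang K w I (from_nat n)) c"
    then obtain N where N: "A = to_nat N" "sound_rule K \<Phi> N cs" unfolding assms(1) ctx_rules_def by blast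
    then show "z \<in> ctx_lang K w I (from_nat A)" using z assms(2) by (simp add: sound_rule_def)
  qed
  from this[of "to_nat N"] show ?thesis by simp
qed

fun hyp_bounded :: "nat \<Rightarrow> 'a hyp \<Rightarrow> bool" where
  "hyp_bounded K (UAtom b U v a) = (nat \<bar>a\<bar> + 2 < K)"
| "hyp_bounded K EqXY = True"
| "hyp_bounded K LtXY = True"
| "hyp_bounded K (RelAtom S a b) = (S < K \<and> a < K \<and> b < K)"

text \<open>The strict bound on the number of hypotheses leaves room for one extra conjunct in the
  rules for long factors.\<close>

definition clause_bounded :: "nat \<Rightarrow> 'a clause \<Rightarrow> bool" where
  "clause_bounded K c \<longleftrightarrow> length (fst c) < K \<and> (\<forall>k\<in>set (fst c). hyp_bounded K k) \<and> snd c \<in> ctx_heads K"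

text \<open>Each single bound holds for all sufficiently large \<open>K\<close>, and there are
  finitely many of them.\<close>

lemma ex_clause_bound:
  fixes \<Phi> :: "'a incl_horn"
  shows "\<exists>K>0. \<forall>c\<in>set \<Phi>. clause_bounded K c"
proof -
  have lt: "eventually (\<lambda>K. m < K) sequentially" for m :: nat by (rule eventually_gt_at_top)
  have hyp: "eventually (\<lambda>K. hyp_bounded K k) sequentially" for k :: "'a hyp"
  proof (cases k)
    case (UAtom b U v a)
    then show ?thesis using lt[of "nat \<bar>a\<bar> + 2"] by simp
  next
    case (RelAtom S a b)
    then show ?thesis using lt by (simp add: eventually_conj_iff)
  qed simp_all
  have head: "eventually (\<lambda>K. h \<in> ctx_heads K) sequentially" for h
  proof (cases h)
    case (HeadRel R)
    then have "h \<in> ctx_heads K \<longleftrightarrow> R < K" for K by (auto simp: ctx_heads_def)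
    then show ?thesis using lt[of R] by simp
  qed (simp add: ctx_heads_def)
  have "eventually (\<lambda>K. clause_bounded K c) sequentially" for c :: "'a clause"
    unfolding clause_bounded_def by (intro eventually_conj lt head eventually_ball_finite ballI hyp) simp
  then have "eventually (\<lambda>K. 0 < K \<and> (\<forall>c\<in>set \<Phi>. clause_bounded K c)) sequentially"
    by (intro eventually_conj lt eventually_ball_finite ballI) simp_all
  then show ?thesis by (metis (no_types, lifting) eventually_sequentially order_refl)
qed

section \<open>The context grammar and its canonical model\<close>

locale ctx_grammar =
  fixes \<Phi> :: "'a::finite incl_horn" and K :: nat and P :: "'a lcg_rules"
  assumes K_pos: "K > 0" and bounded: "\<And>c. c \<in> set \<Phi> \<Longrightarrow> clause_bounded K c"
    and set_P: "set P = ctx_rules K \<Phi>"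
begin

abbreviation lang :: "'a ctx_nt \<Rightarrow> 'a list set" where
  "lang N \<equiv> lcg_lang P (to_nat N)"

lemma lang_intro:
  assumes "N \<in> ctx_nts K" "set cs \<subseteq> ctx_conjs K" "length cs \<le> K" "cs \<noteq> []"
    and "\<And>w I z. horn_model \<Phi> w I \<Longrightarrow>
      (\<And>c. c \<in> set cs \<Longrightarrow> z \<in> conj_lang (\<lambda>n. ctx_lang K w I (from_nat n)) c) \<Longrightarrow> z \<in> ctx_lang K w I N"
    and "\<And>c. c \<in> set cs \<Longrightarrow> z \<in> conj_lang (lcg_lang P) c"
  shows "z \<in> lang N"
proof (rule lcg_lang_intro)
  have "sound_rule K \<Phi> N cs" unfolding sound_rule_def using assms(5) by blast
  with assms(1-4) show "(to_nat N, cs) \<in> set P" unfolding set_P ctx_rules_def by blast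
qed (rule assms(6))

lemma NTW_in_ctx_conjs:
  fixes u v :: "'a list" and N :: "'a ctx_nt"
  assumes "length u \<le> K" "length v \<le> K" "N \<in> ctx_nts K"
  shows "NTW u (to_nat N) v \<in> ctx_conjs K"
  unfolding ctx_conjs_def by (intro UnI2 image_eqI[of _ _ "(u, N, v)"]) (use assms in auto)

lemma Some_in_ctx_nts: "h \<in> ctx_heads K \<Longrightarrow> length l \<le> K \<Longrightarrow> length r \<le> K \<Longrightarrow> Some (h, l, r) \<in> ctx_nts K"
  unfolding ctx_nts_def by simp

lemma lang_None: "z \<in> lang None"
proof (induction z)
  case Nil
  show ?case
    by (rule lang_intro[where cs = "[TermW []]"])
      (use K_pos in \<open>auto simp: ctx_nts_def ctx_conjs_def ctx_lang_def Suc_le_eq\<close>)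
next
  case (Cons c z)
  show ?case
    by (rule lang_intro[where cs = "[NTW [c] (to_nat (None :: 'a ctx_nt)) []]"])
      (use K_pos Cons in \<open>auto simp: ctx_nts_def ctx_lang_def Suc_le_eq intro!: NTW_in_ctx_conjs\<close>)
qed

text \<open>A contradiction at any \<open>(x, y)\<close> refutes the whole word, so it is propagated outwards.\<close>
lemma lang_Bot_left:
  assumes "length r \<le> K" "z \<in> lang (Some (HeadBot, lastn K p, r))"
  shows "p @ z \<in> lang (Some (HeadBot, [], r))"
  using assms(2)
proof (induction p arbitrary: z rule: rev_induct)
  case (snoc c p)
  \<comment> \<open>One letter moves from the left context into the factor. The rule is correct
    because the truncation of a context extended by \<open>c\<close> depends only on its previous
    truncation.\<close>
  have "c # z \<in> lang (Some (HeadBot, lastn K p, r))"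
  proof (rule lang_intro[where cs = "[NTW [c] (to_nat (Some (HeadBot, lastn K (p @ [c]), r))) []]"])
    fix w I z
    assume "\<And>d. d \<in> set [NTW [c] (to_nat (Some (HeadBot, lastn K (p @ [c]), r))) []] \<Longrightarrow>
      z \<in> conj_lang (\<lambda>n. ctx_lang K w I (from_nat n)) d"
    then obtain m where m: "z = c # m" "m \<in> ctx_lang K w I (Some (HeadBot, lastn K (p @ [c]), r))" by force
    have False if w: "w = p' @ z @ s'" "lastn K p' = lastn K p" "take K s' = r" for p' s'
    proof -
      have "w = (p' @ [c]) @ m @ s'" using w(1) m(1) by simp
      moreover have "lastn K (p @ [c]) = lastn K (p' @ [c])" using w(2) by (metis lastn_append_cong)
      ultimately have "head_holds I (Suc (length (p' @ [c]))) (length (p' @ [c]) + length m) HeadBot"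
        using m(2) w(3) by (intro ctx_lang_SomeD[where s = s' and K = K]) simp
      then show False by simp
    qed
    then show "z \<in> ctx_lang K w I (Some (HeadBot, lastn K p, r))"
      using m(1) unfolding ctx_lang_def by auto
  qed (use K_pos assms(1) snoc.prems in
      \<open>auto simp: ctx_heads_def Suc_le_eq intro!: NTW_in_ctx_conjs Some_in_ctx_nts\<close>)
  from snoc.IH[OF this] show ?case by simp
qed simp

lemma lang_Bot_right:
  assumes "length l \<le> K" "z \<in> lang (Some (HeadBot, l, take K s))"
  shows "z @ s \<in> lang (Some (HeadBot, l, []))"
  using assms(2)
proof (induction s arbitrary: z)
  case (Cons c s)
  have "z @ [c] \<in> lang (Some (HeadBot, l, take K s))"
  proof (rule lang_intro[where cs = "[NTW [] (to_nat (Some (HeadBot, l, take K (c # s)))) [c]]"])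
    fix w I z
    assume "\<And>d. d \<in> set [NTW [] (to_nat (Some (HeadBot, l, take K (c # s)))) [c]] \<Longrightarrow>
      z \<in> conj_lang (\<lambda>n. ctx_lang K w I (from_nat n)) d"
    then obtain m where m: "z = m @ [c]" "m \<in> ctx_lang K w I (Some (HeadBot, l, take K (c # s)))" by force
    have False if w: "w = p' @ z @ s'" "lastn K p' = l" "take K s' = take K s" for p' s'
    proof -
      have "w = p' @ m @ (c # s')" using w(1) m(1) by simp
      moreover have "take K (c # s) = take K (c # s')" using take_append_cong[OF w(3), of "[c]"] by simp
      ultimately have "head_holds I (Suc (length p')) (length p' + length m) HeadBot"
        using m(2) w(2) by (intro ctx_lang_SomeD[where s = "c # s'" and K = K]) simp
      then show False by simp
    qed
    then show "z \<in> ctx_lang K w I (Some (HeadBot, l, take K s))"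
      using m(1) unfolding ctx_lang_def by auto
  qed (use K_pos assms(1) Cons.prems in
      \<open>auto simp: ctx_heads_def Suc_le_eq intro!: NTW_in_ctx_conjs Some_in_ctx_nts\<close>)
  from Cons.IH[OF this] show ?case by simp
qed simp

text \<open>Candidate model read off from the grammar, each factor being tested in its actual
  truncated contexts.\<close>

definition canonical :: "'a list \<Rightarrow> nat \<Rightarrow> (nat \<times> nat) set" where
  "canonical w R = spans w (\<lambda>p z s. z \<in> lang (Some (HeadRel R, lastn K p, take K s)))"

lemma canonical_iff:
  assumes "w = p @ z @ s" "z \<noteq> []"
  shows "(Suc (length p), length p + length z) \<in> canonical w R \<longleftrightarrow>
    z \<in> lang (Some (HeadRel R, lastn K p, take K s))"
  unfolding canonical_def assms(1) by (rule spans_iff[OF assms(2)])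

lemma sound: "horn_model \<Phi> w I \<Longrightarrow> z \<in> lang N \<Longrightarrow> z \<in> ctx_lang K w I N"
  using lcg_lang_ctx_sound[OF set_P] by blast

text \<open>The rule with the single conjunct \<open>TermW z\<close> is correct. In any model, at
  any occurrence of \<open>z\<close> with the same truncated contexts, unary hypotheses persist by
  locality; relational ones persist because they hold in \<open>canonical\<close> through
  derivations, and derivations are sound in all models.\<close>

lemma lang_clause_short:
  assumes clause: "(hs, h) \<in> set \<Phi>" and z: "z \<noteq> []" "length z \<le> 2 * K"
    and hyps: "hyps_hold_at (canonical (p @ z @ s)) p z s hs"
  shows "z \<in> lang (Some (h, lastn K p, take K s))"
proof (rule lang_intro[where cs = "[TermW z]"])
  fix w I z'
  assume model: "horn_model \<Phi> w I"
    and "\<And>c. c \<in> set [TermW z] \<Longrightarrow> z' \<in> conj_lang (\<lambda>n. ctx_lang K w I (from_nat n)) c"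
  then have "z' = z" by force
  have "head_holds I (Suc (length p')) (length p' + length z) h"
    if w: "w = p' @ z @ s'" "lastn K p' = lastn K p" "take K s' = take K s" for p' s'
  proof (rule horn_modelD[OF _ z(1) clause])
    show "horn_model \<Phi> (p' @ z @ s') I" using model w by simp
    have "hyp_holds (p' @ z @ s') I (Suc (length p')) (length p' + length z) k" if k: "k \<in> set hs" for k
    proof -
      have hold: "hyp_holds (p @ z @ s) (canonical (p @ z @ s)) (Suc (length p)) (length p + length z) k"
        using hyps k by (auto simp: hyps_hold_at_def)
      have bnd: "hyp_bounded K k" using bounded[OF clause] k by (auto simp: clause_bounded_def)
      show ?thesis
      proof (cases k)
        case (UAtom b U v a)
        have "hyp_holds (p @ z @ s) (canonical (p @ z @ s)) (Suc (length p)) (length p + length z) k \<longleftrightarrow>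
          hyp_holds (p' @ z @ s') I (Suc (length p')) (length p' + length z) k"
          unfolding UAtom
          by (rule hyp_holds_UAtom_local[where K = K])
            (use w(2,3) lastn_append_cong[OF w(2), of z] take_append_cong[OF w(3), of z] z bnd UAtom in auto)
        with hold show ?thesis by blast
      next
        case (RelAtom S a b)
        define d where "d = min a (length z - 1 + length s)"
        define e where "e = min b (length p + length z - 1)"
        have ab: "a < K" "b < K" using bnd RelAtom by auto
        \<comment> \<open>Clamping may occur for a short factor, but equal truncated contexts clamp
          the displacements in the same way, so both occurrences select the same middle
          \<open>m\<close>.\<close>
        have "min K (length s) = min K (length s')" using w(3) by (metis length_take min.commute)
        then have d: "d = min a (length z - 1 + length s')"
          unfolding d_def by (rule min_add_cong) (rule ab)
        have comm: "length q + length z - 1 = length z - 1 + length q" for q :: "'a list"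
          using z(1) by (cases z) auto
        have "min K (length p) = min K (length p')" using w(2) by (metis length_lastn)
        then have e: "e = min b (length p' + length z - 1)"
          unfolding e_def comm by (rule min_add_cong) (rule ab)
        have len: "d + e < length z"
          using hold unfolding RelAtom hyp_holds_RelAtom_iff[OF z(1)] d_def e_def by blast
        define u m v where "u = take d z" and "m = take (length z - e - d) (drop d z)" and "v = drop (length z - e) z"
        have zm: "z = u @ m @ v"
        proof -
          have "z = take (d + (length z - e - d)) z @ v" using len by (simp add: v_def)
          also have "take (d + (length z - e - d)) z = u @ m" by (simp add: take_add u_def m_def)
          finally show ?thesis by simp
        qed
        have m: "m \<noteq> []" "length u = d" "length v = e" using len by (auto simp: u_def m_def v_def)
        have "(Suc (length (p @ u)), length (p @ u) + length m) \<in> canonical (p @ z @ s) S"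
          using hold hyp_holds_RelAtom_split[OF zm m(1), of a s b p] m d_def e_def unfolding RelAtom by blast
        then have "m \<in> lang (Some (HeadRel S, lastn K (p @ u), take K (v @ s)))"
          using canonical_iff[of "p @ z @ s" "p @ u" m "v @ s"] zm m(1) by simp
        then have "m \<in> ctx_lang K w I (Some (HeadRel S, lastn K (p @ u), take K (v @ s)))"
          by (rule sound[OF model])
        moreover have "w = (p' @ u) @ m @ (v @ s')" using w(1) zm by simp
        moreover have "lastn K (p @ u) = lastn K (p' @ u)" "take K (v @ s) = take K (v @ s')"
          using w lastn_append_cong take_append_cong by metis+
        ultimately have "head_holds I (Suc (length (p' @ u))) (length (p' @ u) + length m) (HeadRel S)"
          by (intro ctx_lang_SomeD[where s = "v @ s'" and K = K]) simp
        then show ?thesis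
          unfolding RelAtom hyp_holds_RelAtom_split[OF zm m(1) m(2)[unfolded d] m(3)[unfolded e]]
          by (simp only: head_holds.simps)
      qed (use hold in auto)
    qed
    then show "hyps_hold_at I p' z s' hs" by (simp add: hyps_hold_at_def)
  qed
  then show "z' \<in> ctx_lang K w I (Some (h, lastn K p, take K s))"
    using z \<open>z' = z\<close> by (simp add: ctx_lang_def)
next
  show "Some (h, lastn K p, take K s) \<in> ctx_nts K"
    using bounded[OF clause] by (intro Some_in_ctx_nts) (auto simp: clause_bounded_def)
qed (use K_pos z in \<open>auto simp: ctx_conjs_def\<close>)

text \<open>A long factor is handled by one conjunct per relational hypothesis together with
  \<open>any\<close>, which fixes its first and last \<open>K\<close> letters. These flanks and the
  contexts determine all unary hypotheses, and displacements below \<open>K\<close> are never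
  clamped.\<close>

lemma lang_clause_long:
  assumes clause: "(hs, h) \<in> set \<Phi>" and z: "length z > 2 * K"
    and hyps: "hyps_hold_at (canonical (p @ z @ s)) p z s hs"
  shows "z \<in> lang (Some (h, lastn K p, take K s))"
proof -
  define u m v where "u = take K z" and "m = take (length z - K - K) (drop K z)" and "v = drop (length z - K) z"
  have zm: "z = u @ m @ v"
  proof -
    have "z = take (K + (length z - K - K)) z @ v" using z by (simp add: v_def)
    also have "take (K + (length z - K - K)) z = u @ m" by (simp add: take_add u_def m_def)
    finally show ?thesis by simp
  qed
  have uv: "length u = K" "length v = K" using z by (auto simp: u_def v_def)
  \<comment> \<open>The letters skipped by the shifts, the first \<open>a\<close> of
    \<open>u\<close> and the last \<open>b\<close> of \<open>v\<close>, become terminals and extend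
    the contexts of the inner factor.\<close>
  define rel where "rel = (\<lambda>S a b. NTW (take a u) (to_nat (Some (HeadRel S, lastn K (p @ take a u),
     take K (drop (K - b) v @ s)))) (drop (K - b) v))"
  define any where "any = NTW u (to_nat (None :: 'a ctx_nt)) v"
  define conj :: "'a hyp \<Rightarrow> 'a lconj" where "conj = (\<lambda>k. case k of RelAtom S a b \<Rightarrow> rel S a b | _ \<Rightarrow> any)"
  have bnd: "hyp_bounded K k" if "k \<in> set hs" for k
    using bounded[OF clause] that by (auto simp: clause_bounded_def)
  have z_ne: "z \<noteq> []" using z by auto
  show ?thesis
  proof (rule lang_intro[where cs = "any # map conj hs"])
    fix w I z'
    assume model: "horn_model \<Phi> w I"
      and z': "\<And>c. c \<in> set (any # map conj hs) \<Longrightarrow> z' \<in> conj_lang (\<lambda>n. ctx_lang K w I (from_nat n)) c"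
    have "z' \<in> conj_lang (\<lambda>n. ctx_lang K w I (from_nat n)) any" using z' by simp
    then obtain m' where zm': "z' = u @ m' @ v" by (auto simp: any_def)
    have len': "length z' \<ge> 2 * K" using zm' uv by simp
    then have z'_ne: "z' \<noteq> []" using K_pos by auto
    have "head_holds I (Suc (length p')) (length p' + length z') h"
      if w: "w = p' @ z' @ s'" "lastn K p' = lastn K p" "take K s' = take K s" for p' s'
    proof (rule horn_modelD[OF _ z'_ne clause])
      show "horn_model \<Phi> (p' @ z' @ s') I" using model w by simp
      have "hyp_holds (p' @ z' @ s') I (Suc (length p')) (length p' + length z') k" if k: "k \<in> set hs" for k
      proof -
        have hold: "hyp_holds (p @ z @ s) (canonical (p @ z @ s)) (Suc (length p)) (length p + length z) k"
          using hyps k by (auto simp: hyps_hold_at_def)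
        show ?thesis
        proof (cases k)
          case (UAtom b U x a)
          \<comment> \<open>Around the right cut both words show \<open>v\<close> and the same right
            context; around the left cut, the same left context and \<open>u\<close>.\<close>
          have "lastn K (p @ z) = v" "lastn K (p' @ z') = v"
            using lastn_append_long[of K v "p @ u @ m"] lastn_append_long[of K v "p' @ u @ m'"] uv
            by (simp_all add: zm zm' lastn_def)
          then have "hyp_holds (p @ z @ s) (canonical (p @ z @ s)) (Suc (length p)) (length p + length z) k \<longleftrightarrow>
            hyp_holds (p' @ z' @ s') I (Suc (length p')) (length p' + length z') k"
            unfolding UAtom
            by (intro hyp_holds_UAtom_local[where K = K])
              (use w z_ne z'_ne bnd[OF k] UAtom uv in \<open>auto simp: zm zm'\<close>)
          with hold show ?thesis by blast
        next
          case (RelAtom S a b)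
          have ab: "a < K" "b < K" using bnd[OF k] RelAtom by auto
          have "z' \<in> conj_lang (\<lambda>n. ctx_lang K w I (from_nat n)) (rel S a b)"
          proof -
            have "conj k \<in> set (any # map conj hs)" using k by simp
            from z'[OF this] show ?thesis by (simp add: conj_def RelAtom)
          qed
          then obtain m3 where m3: "z' = take a u @ m3 @ drop (K - b) v"
            "m3 \<in> ctx_lang K w I (Some (HeadRel S, lastn K (p @ take a u), take K (drop (K - b) v @ s)))"
            by (auto simp: rel_def)
          have "m3 \<noteq> []" using m3(2) by (auto simp: ctx_lang_def)
          have "w = (p' @ take a u) @ m3 @ (drop (K - b) v @ s')" using w(1) m3(1) by simp
          moreover have "lastn K (p @ take a u) = lastn K (p' @ take a u)"
            "take K (drop (K - b) v @ s) = take K (drop (K - b) v @ s')"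
            using w lastn_append_cong take_append_cong by metis+
          ultimately have head: "head_holds I (Suc (length (p' @ take a u))) (length (p' @ take a u) + length m3) (HeadRel S)"
            using m3(2) by (intro ctx_lang_SomeD[where s = "drop (K - b) v @ s'" and K = K]) simp
          have len: "length (take a u) = min a (length z' - 1 + length s')"
            "length (drop (K - b) v) = min b (length p' + length z' - 1)"
            using ab uv len' K_pos by auto
          from head show ?thesis
            unfolding RelAtom hyp_holds_RelAtom_split[OF m3(1) \<open>m3 \<noteq> []\<close> len] by (simp only: head_holds.simps)
        \<comment> \<open>Both factors have at least two letters, so \<open>EqXY\<close> fails and
          \<open>LtXY\<close> holds in both.\<close>
        qed (use hold z len' K_pos in auto)
      qed
      then show "hyps_hold_at I p' z' s' hs" by (simp add: hyps_hold_at_def)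
    qed
    then show "z' \<in> ctx_lang K w I (Some (h, lastn K p, take K s))"
      using z'_ne by (simp add: ctx_lang_def)
  next
    fix c assume "c \<in> set (any # map conj hs)"
    moreover have any: "z \<in> conj_lang (lcg_lang P) any"
      using zm lang_None by (auto simp: any_def)
    moreover have "z \<in> conj_lang (lcg_lang P) (conj k)" if k: "k \<in> set hs" for k
    proof (cases k)
      case (RelAtom S a b)
      have ab: "a < K" "b < K" using bnd[OF k] RelAtom by auto
      define m3 where "m3 = drop a u @ m @ take (K - b) v"
      have z3: "z = take a u @ m3 @ drop (K - b) v" by (simp add: zm m3_def)
      have "m3 \<noteq> []" using ab uv by (simp add: m3_def)
      have "length (take a u) = min a (length z - 1 + length s)"
        "length (drop (K - b) v) = min b (length p + length z - 1)"
        using ab uv z by auto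
      moreover have "hyp_holds (p @ z @ s) (canonical (p @ z @ s)) (Suc (length p)) (length p + length z) (RelAtom S a b)"
        using hyps k RelAtom by (auto simp: hyps_hold_at_def)
      ultimately have "(Suc (length (p @ take a u)), length (p @ take a u) + length m3) \<in> canonical (p @ z @ s) S"
        using hyp_holds_RelAtom_split[OF z3 \<open>m3 \<noteq> []\<close>, of a s b p] by blast
      then have "m3 \<in> lang (Some (HeadRel S, lastn K (p @ take a u), take K (drop (K - b) v @ s)))"
        using canonical_iff[of "p @ z @ s" "p @ take a u" m3 "drop (K - b) v @ s"] z3 \<open>m3 \<noteq> []\<close> by simp
      then show ?thesis using z3 RelAtom by (auto simp: conj_def rel_def)
    qed (use any in \<open>simp_all add: conj_def\<close>)
    ultimately show "z \<in> conj_lang (lcg_lang P) c" by auto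
  next
    have any: "any \<in> ctx_conjs K"
      unfolding any_def using uv by (intro NTW_in_ctx_conjs) (simp_all add: ctx_nts_def)
    have "conj k \<in> ctx_conjs K" if k: "k \<in> set hs" for k
    proof (cases k)
      case (RelAtom S a b)
      then have "HeadRel S \<in> ctx_heads K" "b \<le> K" using bnd[OF k] by (auto simp: ctx_heads_def)
      then show ?thesis
        unfolding RelAtom conj_def rel_def hyp.case
        by (intro NTW_in_ctx_conjs Some_in_ctx_nts) (simp_all add: uv)
    qed (use any in \<open>simp_all add: conj_def\<close>)
    with any show "set (any # map conj hs) \<subseteq> ctx_conjs K" by auto
    show "length (any # map conj hs) \<le> K" using bounded[OF clause] by (auto simp: clause_bounded_def)
    show "Some (h, lastn K p, take K s) \<in> ctx_nts K"
      using bounded[OF clause] by (intro Some_in_ctx_nts) (auto simp: clause_bounded_def)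
  qed simp
qed

text \<open>A derivation of \<open>HeadBot\<close> refutes every model by soundness. Without one,
  \<open>canonical\<close> satisfies all clauses: each satisfied body yields a derivation of its
  head.\<close>

lemma incl_horn_models_iff:
  assumes "w \<noteq> []"
  shows "incl_horn_models w \<Phi> \<longleftrightarrow> w \<notin> lang (Some (HeadBot, [], []))"
proof
  assume "incl_horn_models w \<Phi>"
  then obtain I where I: "horn_model \<Phi> w I" unfolding incl_horn_models_def horn_model_def by blast
  show "w \<notin> lang (Some (HeadBot, [], []))"
  proof
    assume "w \<in> lang (Some (HeadBot, [], []))"
    with sound[OF I] have "w \<in> ctx_lang K ([] @ w @ []) I (Some (HeadBot, lastn K [], take K []))" by simp
    from ctx_lang_SomeD[OF this] show False by simp
  qed
next
  assume not_lang: "w \<notin> lang (Some (HeadBot, [], []))"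
  have "clause_holds w (canonical w) x y c"
    if xy: "x \<in> {1..length w}" "y \<in> {1..length w}" and c: "c \<in> set \<Phi>" for x y c
    unfolding clause_holds_def
  proof (intro impI, elim conjE)
    assume "x \<le> y" and hyps: "\<forall>h\<in>set (fst c). hyp_holds w (canonical w) x y h"
    have "1 \<le> x" "y \<le> length w" using xy by auto
    from this(1) \<open>x \<le> y\<close> this(2) obtain p z s
      where w: "w = p @ z @ s" "z \<noteq> []" "x = Suc (length p)" "y = length p + length z"
      by (rule interval_split)
    have "hyps_hold_at (canonical (p @ z @ s)) p z s (fst c)" using hyps w by (simp add: hyps_hold_at_def)
    with lang_clause_short[of "fst c" "snd c" z p s] lang_clause_long[of "fst c" "snd c" z p s] c w(2)
    have z: "z \<in> lang (Some (snd c, lastn K p, take K s))" by fastforce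
    show "head_holds (canonical w) x y (snd c)"
    proof (cases "snd c")
      case (HeadRel R)
      then show ?thesis using z canonical_iff[OF w(1,2)] w by simp
    next
      case HeadBot
      \<comment> \<open>A contradiction at the factor \<open>z\<close> would grow to one for the
        whole word, first to the left and then to the right.\<close>
      have "p @ z \<in> lang (Some (HeadBot, [], take K s))"
        using z HeadBot by (intro lang_Bot_left) auto
      then have "(p @ z) @ s \<in> lang (Some (HeadBot, [], []))"
        by (intro lang_Bot_right) auto
      with not_lang w show ?thesis by simp
    qed
  qed
  moreover have "canonical w R \<subseteq> {1..length w} \<times> {1..length w}" for R
    unfolding canonical_def by (rule spans_subset)
  ultimately show "incl_horn_models w \<Phi>" unfolding incl_horn_models_def by blast
qed

text \<open>The empty word has no positions, so every clause holds there vacuously and soundness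
  applies. This keeps the generated language within the nonempty words, as the complement
  demands.\<close>

lemma Nil_notin_lang: "[] \<notin> lang (Some (h, l, r))"
  using sound[of "[]" "\<lambda>_. {}"] by (fastforce simp: horn_model_def ctx_lang_def)

end

theorem theorem3:
  fixes L :: "'a::finite list set"
  assumes "L \<subseteq> {w. w \<noteq> []}"
  shows "L \<in> incl_ESO_HORN \<longleftrightarrow> ({w. w \<noteq> []} - L) \<in> LinConj"
proof
  assume "L \<in> incl_ESO_HORN"
  then obtain \<Phi> where L: "L = {w. w \<noteq> [] \<and> incl_horn_models w \<Phi>}" unfolding incl_ESO_HORN_def by blast
  obtain K where K: "K > 0" "\<And>c. c \<in> set \<Phi> \<Longrightarrow> clause_bounded K c" using ex_clause_bound[of \<Phi>] by blast
  obtain P where P: "set P = ctx_rules K \<Phi>" using finite_list[OF finite_ctx_rules] by blast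
  interpret ctx_grammar \<Phi> K P by unfold_locales (use K P in auto)
  have "{w. w \<noteq> []} - L = lang (Some (HeadBot, [], []))"
    unfolding L using incl_horn_models_iff Nil_notin_lang by blast
  moreover have "\<forall>(A, cs)\<in>set P. cs \<noteq> []" unfolding P ctx_rules_def by blast
  ultimately show "({w. w \<noteq> []} - L) \<in> LinConj" unfolding LinConj_def by blast
next
  assume "({w. w \<noteq> []} - L) \<in> LinConj"
  then obtain P S where PS: "{w. w \<noteq> []} - L = lcg_lang P S" unfolding LinConj_def by blast
  have "w \<in> L \<longleftrightarrow> w \<noteq> [] \<and> incl_horn_models w (grammar_horn P S)" for w
    using grammar_horn_sound[of w P S] grammar_horn_complete[of w P S] assms
    unfolding PS[symmetric] by blast
  then show "L \<in> incl_ESO_HORN" unfolding incl_ESO_HORN_def by blast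
qed

end
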